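(* Let $q$ be an odd prime power, $\beta\in\mathbb{F}_q^*$, and let $\theta_1,\theta_2\in\mathbb{F}_{q^2}$ form an $\mathbb{F}_q$-basis of $\mathbb{F}_{q^2}$ with $\mathrm{Tr}(\theta_1)=\beta$, $\mathrm{Tr}(\theta_2)=0$. Write $q^2-1=2^\ell q_2$ with $q_2$ odd and let $q_2'$ be the product of the distinct primes dividing $q_2$. Write $q_2'=kp_1\cdots p_s$ with $p_1,\dots,p_s$ distinct primes (not dividing $k$), ordered so that $p_i\mid q+1$ for $1\le i\le r$ and $p_i\nmid q+1$ for $r<i\le s$. Let $\varepsilon=1-\sum_{i=1}^s\frac1{p_i}$ ($\varepsilon=1$ if $s=0$), $\varepsilon'=1-\sum_{i=1}^r\frac1{p_i}$, and let $k_1$ be the product of the primes dividing $k$ which divide $q+1$. Assume $\varepsilon>0$. For $m\mid q_2'$ let $\mathcal{Q}_m$ be the number of $\alpha\in\mathbb{F}_q$ such that $\theta_1+\alpha\theta_2$ is $m$-free, a square in $\mathbb{F}_{q^2}$, and not a fourth power in $\mathbb{F}_{q^2}$. (1) If $q\equiv1\pmod4$ and $$q+1>4\left[W(k)\left(\frac{s-1}{\varepsilon}+2\right)\sqrt q-W(k_1)\left(\frac{r-1+\varepsilon'}{\varepsilon}+1\right)\frac{\sqrt q-1}{2}\right],$$ then $\mathcal{Q}_{q_2'}\ne0$. (2) If $q\equiv3\pmod4$ and $$q+1>4\left[W(k)\left(\frac{s-1}{\varepsilon}+2\right)\sqrt q-W(k_1)\left(\frac{r-1+\varepsilon'}{\varepsilon}+1\right)(\sqrt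 q-1)\right],$$ then $\mathcal{Q}_{q_2'}\ne0$. In particular, $\mathcal{Q}_{q_2'}>0$ whenever $\sqrt q\ge 4W(k)\left(\frac{s-1}{\varepsilon}+2\right)$.
   Context: $\mathrm{Tr}:\mathbb{F}_{q^2}\to\mathbb{F}_q$ is $\xi\mapsto\xi+\xi^q$. For a divisor $m$ of $q^2-1$, $\xi\in\mathbb{F}_{q^2}^*$ is $m$-free if $\xi=\zeta^d$ with $d\mid m$, $\zeta\in\mathbb{F}_{q^2}^*$ implies $d=1$. $W(m)=2^{\nu(m)}$ with $\nu(m)$ the number of distinct prime divisors of $m$. *)

theory Defs
  imports Complex_Main "HOL-Number_Theory.Number_Theory"
    "HOL-Computational_Algebra.Nth_Powers" "HOL-Library.Cardinality"
begin

(* The field with q^2 elements is a finite field type 'a with CARD('a) = q^2;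
   the field with q elements is a subset F of 'a which is a subfield with card F = q. *)

definition is_subfield :: "'a::field set \<Rightarrow> bool" where
  "is_subfield F \<longleftrightarrow> 0 \<in> F \<and> 1 \<in> F \<and>
     (\<forall>x\<in>F. \<forall>y\<in>F. x + y \<in> F) \<and> (\<forall>x\<in>F. - x \<in> F) \<and>
     (\<forall>x\<in>F. \<forall>y\<in>F. x * y \<in> F) \<and> (\<forall>x\<in>F. x \<noteq> 0 \<longrightarrow> inverse x \<in> F)"

definition is_basis2 :: "'a::field set \<Rightarrow> 'a \<Rightarrow> 'a \<Rightarrow> bool" where
  "is_basis2 F u v \<longleftrightarrow>
     (\<forall>a\<in>F. \<forall>b\<in>F. a * u + b * v = 0 \<longrightarrow> a = 0 \<and> b = 0) \<and>
     (\<forall>x. \<exists>a\<in>F. \<exists>b\<in>F. x = a * u + b * v)"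

definition Tr :: "nat \<Rightarrow> 'a::field \<Rightarrow> 'a" where
  "Tr q \<xi> = \<xi> + \<xi> ^ q"

definition m_free :: "nat \<Rightarrow> 'a::field \<Rightarrow> bool" where
  "m_free m \<xi> \<longleftrightarrow> \<xi> \<noteq> 0 \<and> (\<forall>d \<zeta>. d dvd m \<and> \<zeta> \<noteq> 0 \<and> \<xi> = \<zeta> ^ d \<longrightarrow> d = 1)"

definition W :: "nat \<Rightarrow> nat" where
  "W m = 2 ^ card (prime_factors m)"

definition Q_count :: "'a::field set \<Rightarrow> 'a \<Rightarrow> 'a \<Rightarrow> nat \<Rightarrow> nat" where
  "Q_count F \<theta>1 \<theta>2 m =
     card {\<alpha> \<in> F. m_free m (\<theta>1 + \<alpha> * \<theta>2) \<and>
                   is_nth_power 2 (\<theta>1 + \<alpha> * \<theta>2) \<and> \<not> is_nth_power 4 (\<theta>1 + \<alpha> * \<theta>2)}"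

end

theory Submission
  imports Defs
begin

text \<open>
  The points \<open>\<theta>1 + \<alpha> \<theta>2\<close> form an affine line not through 0. The ratios of two distinct points of the
  line take every value outside \<open>F\<close> exactly once, so for a multiplicative character \<open>\<chi>\<close> the sum \<open>S\<close> of
  \<open>\<chi>\<close> over the line satisfies \<open>|S|^2 = q + (sum of \<chi> outside F)\<close>. Hence \<open>|S| = sqrt q\<close> if \<open>\<chi>\<close> is
  nontrivial on \<open>F\<close>, and \<open>|S| = 1\<close> if \<open>\<chi>\<close> is nontrivial but trivial on \<open>F\<close>, which is the case when
  the order of \<open>\<chi>\<close> divides \<open>q + 1\<close>. No Gauss sums are needed.

  The indicator of ``square, not a fourth power'' is \<open>(1 + \<chi>^2 - \<chi> - \<chi>^3) / 4\<close> with \<open>\<chi>\<close> of order 4,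
  and that of ``not a \<open>t\<close>-th power'' is \<open>1 - 1/t\<close> times 1 minus the average of the characters of
  order \<open>t\<close>. Expanding the product over the primes of \<open>k\<close> gives the error terms with \<open>W(k)\<close> and
  \<open>W(k1)\<close>; the remaining primes are removed by the union bound, in which the loss from a prime \<open>t\<close>
  is \<open>1/t\<close> times the count for \<open>k\<close>, up to an error made of characters of order divisible by \<open>t\<close>.
\<close>

section \<open>Finite fields, subfields and elementary estimates\<close>

text \<open>Cyclicity comes from the finite-field theorem for structures with an explicit carrier;
  \<open>R\<close> is the type viewed as such a structure.\<close>

lemma exists_generator_of_units:
  "\<exists>g :: 'a::{field,finite}. g \<noteq> 0 \<and> (\<forall>x. x \<noteq> 0 \<longrightarrow> (\<exists>i::nat. x = g ^ i))"
proof -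
  define R :: "'a ring" where
    "R = \<lparr>carrier = UNIV, mult = (*), one = 1, zero = 0, add = (+)\<rparr>"
  have simps: "carrier R = UNIV" "mult R = (*)" "one R = 1" "zero R = 0" "add R = (+)"
    by (simp_all add: R_def)
  have "comm_group (add_monoid R)"
  proof (rule comm_groupI)
    fix x assume "x \<in> carrier (add_monoid R)"
    show "\<exists>y\<in>carrier (add_monoid R). y \<otimes>\<^bsub>add_monoid R\<^esub> x = \<one>\<^bsub>add_monoid R\<^esub>"
      by (rule bexI[of _ "- x"]) (auto simp: simps)
  qed (auto simp: simps algebra_simps)
  then have "abelian_group R"
    by (rule comm_group_abelian_groupI)
  moreover have "comm_monoid R"
    by (rule comm_monoidI) (auto simp: simps algebra_simps)
  ultimately have cr: "cring R"
    by (rule cringI) (auto simp: simps algebra_simps)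
  have "Units R = carrier R - {\<zero>\<^bsub>R\<^esub>}"
  proof -
    have "\<exists>y. y * x = 1" if "x \<noteq> 0" for x :: 'a
      using that by (intro exI[of _ "inverse x"]) auto
    then show ?thesis
      by (auto simp: Units_def simps mult.commute)
  qed
  then interpret R: field R
    using cr by (intro cring.cring_fieldI)
  have pow: "x [^]\<^bsub>R\<^esub> (i::nat) = x ^ i" for x i
    by (induction i) (auto simp: simps)
  obtain g where g: "g \<in> carrier (mult_of R)"
    "carrier (mult_of R) = {g [^]\<^bsub>R\<^esub> i | i::nat. i \<in> UNIV}"
    using R.finite_field_mult_group_has_gen by (auto simp: simps)
  then show ?thesis
    by (intro exI[of _ g]) (auto simp: simps pow set_eq_iff)
qed

text \<open>Multiplication by \<open>x\<close> permutes the nonzero elements of \<open>F\<close>, so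
  their product absorbs the factor \<open>x ^ (card F - 1)\<close>. This serves both for the whole
  field and for the subfield.\<close>

lemma subfield_power_card_minus_1:
  fixes F :: "'a::field set"
  assumes "is_subfield F" "finite F" "x \<in> F" "x \<noteq> 0"
  shows "x ^ (card F - 1) = 1"
proof -
  have "(\<Prod>y\<in>F - {0}. y) = (\<Prod>y\<in>F - {0}. x * y)"
    by (rule prod.reindex_bij_witness[of _ "\<lambda>y. x * y" "\<lambda>y. inverse x * y"])
      (use assms in \<open>auto simp: is_subfield_def\<close>)
  also have "\<dots> = x ^ (card F - 1) * (\<Prod>y\<in>F - {0}. y)"
    using assms by (simp add: prod.distrib card_Diff_singleton is_subfield_def)
  finally show ?thesis
    using assms(2) by simp
qed

lemma is_subfield_UNIV [simp]: "is_subfield UNIV"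
  by (simp add: is_subfield_def)

text \<open>The fraction a/d + b/t stays in lowest terms, so a product of characters of exact orders
  \<open>d\<close> and \<open>t\<close> has exact order \<open>d * t\<close>.\<close>

lemma coprime_combination:
  assumes "coprime a d" "coprime b t" "coprime d (t::nat)"
  shows "coprime (a * t + b * d) (d * t)"
proof -
  have "gcd d (b * d + a * t) = gcd d (a * t)" "gcd t (a * t + b * d) = gcd t (b * d)"
    by (rule gcd_add_mult)+
  moreover have "coprime d (a * t)" "coprime t (b * d)"
    using assms by (simp_all add: ac_simps)
  ultimately have "coprime d (b * d + a * t)" "coprime t (a * t + b * d)"
    by (simp_all only: coprime_iff_gcd_eq_1)
  then show ?thesis
    by (simp add: ac_simps)
qed

lemma norm_average_le:
  fixes f :: "nat \<Rightarrow> complex"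
  assumes "\<And>b. b \<in> {1..<t} \<Longrightarrow> cmod (f b) \<le> B" "t > 1"
  shows "cmod ((\<Sum>b=1..<t. f b) / of_nat (t - 1)) \<le> B"
proof -
  have "cmod (\<Sum>b=1..<t. f b) \<le> of_nat (card {1..<t}) * B"
    using assms(1) by (rule sum_norm_bound)
  moreover have "cmod (of_nat (t - 1)) = real (t - 1)"
    by (rule norm_of_nat)
  ultimately show ?thesis
    using assms(2) by (simp add: norm_divide pos_divide_le_eq mult.commute del: of_nat_diff)
qed

text \<open>In the applications the last two terms come from the two characters of order 4, hence
  their common bound.\<close>

lemma norm_combination_le:
  fixes x y z w :: complex
  assumes "cmod x \<le> a" "cmod y \<le> b" "cmod z \<le> c" "cmod w \<le> c"
  shows "cmod (x + y - z - w) \<le> a + b + 2 * c"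
proof -
  have "cmod (x + y - z - w) \<le> cmod x + cmod y + cmod z + cmod w"
    by (smt (verit) norm_triangle_ineq norm_triangle_ineq4)
  with assms show ?thesis
    by linarith
qed

section \<open>Complex roots of unity\<close>

definition unity_root :: "nat \<Rightarrow> nat \<Rightarrow> complex" where
  "unity_root a d = cis (2 * pi * real a / real d)"

lemma norm_unity_root [simp]: "cmod (unity_root a d) = 1"
  by (simp add: unity_root_def)

lemma unity_root_power: "unity_root a d ^ n = unity_root (a * n) d"
  by (simp add: unity_root_def DeMoivre algebra_simps)

lemma unity_root_eq_1_iff:
  assumes "d > 0"
  shows "unity_root a d = 1 \<longleftrightarrow> d dvd a"
proof
  assume "unity_root a d = 1"
  then have "cos (2 * pi * real a / real d) = 1"
    by (simp add: unity_root_def complex_eq_iff)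
  then obtain m :: int where "2 * pi * real a / real d = real_of_int m * 2 * pi"
    by (auto simp: cos_one_2pi_int)
  then have "real a = real_of_int (m * int d)"
    using assms by (simp add: field_simps)
  then have "int a = m * int d"
    by linarith
  then have "int d dvd int a"
    by simp
  then show "d dvd a"
    by simp
next
  assume "d dvd a"
  then obtain m where "a = d * m" ..
  then show "unity_root a d = 1"
    using assms cis_multiple_2pi[of "real m"] by (simp add: unity_root_def mult.assoc)
qed

lemma unity_root_mult:
  assumes "d > 0" "t > 0"
  shows "unity_root a d * unity_root b t = unity_root (a * t + b * d) (d * t)"
  using assms by (simp add: unity_root_def cis_mult field_simps)

lemma sum_unity_root_powers:
  assumes "t > 0"
  shows "(\<Sum>b<t. unity_root b t ^ i) = (if t dvd i then of_nat t else 0)"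
proof -
  have "(\<Sum>b<t. unity_root b t ^ i) = (\<Sum>b<t. unity_root i t ^ b)"
    by (simp add: unity_root_power mult.commute)
  also have "\<dots> = (if t dvd i then of_nat t else 0)"
  proof (cases "t dvd i")
    case False
    then have "unity_root i t \<noteq> 1" "unity_root i t ^ t = 1"
      using assms by (auto simp: unity_root_eq_1_iff unity_root_power)
    then show ?thesis
      using False by (simp add: sum_gp_strict)
  next
    case True
    then have "unity_root i t = 1"
      using assms by (simp add: unity_root_eq_1_iff)
    then show ?thesis
      using True by simp
  qed
  finally show ?thesis .
qed

section \<open>Characters of the multiplicative group\<close>

locale unit_generator =
  fixes g :: "'a::{field,finite}"
  assumes generator_nonzero: "g \<noteq> 0"
    and generates: "x \<noteq> 0 \<Longrightarrow> \<exists>i. x = g ^ i"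
begin

lemma card_minus_1_pos: "CARD('a) - 1 > 0"
proof -
  have "card {0, 1 :: 'a} \<le> CARD('a)"
    by (rule card_mono) auto
  then show ?thesis
    by simp
qed

lemma generator_power_mod: "g ^ (i mod (CARD('a) - 1)) = g ^ i"
proof -
  have "g ^ i = g ^ ((CARD('a) - 1) * (i div (CARD('a) - 1)) + i mod (CARD('a) - 1))"
    by simp
  then show ?thesis
    unfolding power_add power_mult
    using subfield_power_card_minus_1[of UNIV g] generator_nonzero by simp
qed

lemma generator_power_eq_iff: "g ^ i = g ^ j \<longleftrightarrow> [i = j] (mod (CARD('a) - 1))"
proof -
  let ?N = "CARD('a) - 1"
  \<comment> \<open>The reduced exponents already reach every nonzero element, and both sets have
    the same size, so this surjection is injective.\<close>
  have "(\<lambda>i. g ^ i) ` {..<?N} = UNIV - {0}"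
  proof (intro equalityI subsetI)
    fix x :: 'a assume "x \<in> UNIV - {0}"
    then obtain i where "x = g ^ (i mod ?N)"
      using generates generator_power_mod by force
    then show "x \<in> (\<lambda>i. g ^ i) ` {..<?N}"
      using card_minus_1_pos by auto
  qed (use generator_nonzero in auto)
  then have "inj_on (\<lambda>i. g ^ i) {..<?N}"
    by (intro eq_card_imp_inj_on) (auto simp: card_Diff_singleton)
  then have "g ^ (i mod ?N) = g ^ (j mod ?N) \<longleftrightarrow> i mod ?N = j mod ?N"
    using card_minus_1_pos by (auto simp: inj_on_def)
  then show ?thesis
    unfolding generator_power_mod cong_def .
qed

lemma is_nth_power_generator_iff:
  \<comment> \<open>An exponent is determined modulo the group order, hence modulo its divisor
    \<open>t\<close>; divisibility of the exponent by \<open>t\<close> is thus a property of the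
    element.\<close>
  assumes "t dvd CARD('a) - 1" "t > 0"
  shows "is_nth_power t (g ^ i) \<longleftrightarrow> t dvd i"
proof
  assume "is_nth_power t (g ^ i)"
  then obtain y where y: "g ^ i = y ^ t"
    by (auto simp: is_nth_power_def)
  with assms(2) generator_nonzero have "y \<noteq> 0"
    by (metis power_eq_0_iff)
  then obtain j where "y = g ^ j"
    using generates by blast
  with y have "[i = j * t] (mod (CARD('a) - 1))"
    by (simp add: generator_power_eq_iff flip: power_mult)
  then have "[i = j * t] (mod t)"
    using assms(1) by (rule cong_dvd_modulus_nat)
  then show "t dvd i"
    by (metis cong_dvd_iff dvd_triv_right)
next
  assume "t dvd i"
  then show "is_nth_power t (g ^ i)"
    by (auto simp: is_nth_power_def power_mult mult.commute intro!: exI[of _ "g ^ (i div t)"])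
qed

text \<open>A discrete logarithm, canonical only modulo \<open>CARD('a) - 1\<close>, and arbitrary
  at 0.\<close>

definition ind :: "'a \<Rightarrow> nat" where
  "ind x = (SOME i. x = g ^ i)"

text \<open>The character of order \<open>d\<close> sending \<open>g\<close> to \<open>exp (2 \<pi> i a / d)\<close>, provided \<open>d\<close> divides
  \<open>CARD('a) - 1\<close> and \<open>a\<close> is prime to \<open>d\<close>; its value at 0 is junk.\<close>

definition chi :: "nat \<Rightarrow> nat \<Rightarrow> 'a \<Rightarrow> complex" where
  "chi a d x = unity_root a d ^ ind x"

lemma norm_chi [simp]: "cmod (chi a d x) = 1"
  by (simp add: chi_def norm_power)

text \<open>The choice made by \<open>ind\<close> is harmless: it is fixed modulo \<open>d\<close>,
  and the d-th power of \<open>unity_root a d\<close> is 1.\<close>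

lemma chi_generator_power:
  assumes "d dvd CARD('a) - 1"
  shows "chi a d (g ^ i) = unity_root a d ^ i"
proof -
  have d: "d > 0"
    using assms card_minus_1_pos by (metis dvd_pos_nat)
  have "g ^ i = g ^ ind (g ^ i)"
    unfolding ind_def by (rule someI[of _ i]) simp
  then have "[i = ind (g ^ i)] (mod (CARD('a) - 1))"
    by (simp only: generator_power_eq_iff)
  then have cong: "[i = ind (g ^ i)] (mod d)"
    using assms by (rule cong_dvd_modulus_nat)
  have red: "unity_root a d ^ n = unity_root a d ^ (n mod d)" for n
  proof -
    have "unity_root a d ^ n = unity_root a d ^ (d * (n div d) + n mod d)"
      by simp
    also have "\<dots> = (unity_root a d ^ d) ^ (n div d) * unity_root a d ^ (n mod d)"
      by (simp only: power_add power_mult)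
    also have "unity_root a d ^ d = 1"
      using d by (simp add: unity_root_power unity_root_eq_1_iff)
    finally show ?thesis by simp
  qed
  show ?thesis
    using red[of i] red[of "ind (g ^ i)"] cong by (simp add: chi_def cong_def)
qed

lemma chi_mult:
  assumes "d dvd CARD('a) - 1" "x \<noteq> 0" "y \<noteq> 0"
  shows "chi a d (x * y) = chi a d x * chi a d y"
proof -
  obtain i j where "x = g ^ i" "y = g ^ j"
    using assms generates by blast
  then show ?thesis
    using assms(1) by (metis chi_generator_power power_add)
qed

lemma chi_divide:
  assumes "d dvd CARD('a) - 1" "x \<noteq> 0" "y \<noteq> 0"
  shows "chi a d (x / y) = chi a d x * cnj (chi a d y)"
proof -
  have "chi a d x = chi a d (x / y) * chi a d y"
    using chi_mult[OF assms(1), of "x / y" y a] assms by simp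
  moreover have "chi a d y * cnj (chi a d y) = 1"
    by (simp add: complex_norm_square[symmetric])
  ultimately show ?thesis
    by (simp add: mult.assoc)
qed

lemma chi_coprime_mult:
  assumes "d dvd CARD('a) - 1" "t dvd CARD('a) - 1" "x \<noteq> 0" "coprime d t"
  shows "chi a d x * chi b t x = chi (a * t + b * d) (d * t) x"
proof -
  obtain i where i: "x = g ^ i"
    using assms generates by blast
  have "d > 0" "t > 0"
    using assms card_minus_1_pos by (metis dvd_pos_nat)+
  moreover have "d * t dvd CARD('a) - 1"
    using assms by (simp add: divides_mult)
  ultimately show ?thesis
    using assms by (simp add: i chi_generator_power unity_root_mult flip: power_mult_distrib)
qed

lemma chi_trivial:
  "chi a 1 x = 1"
proof -
  have "unity_root a 1 = 1"
    by (subst unity_root_eq_1_iff) auto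
  then show ?thesis
    by (simp add: chi_def del: One_nat_def)
qed

text \<open>Normalised so that its expansion into characters has constant term 1.\<close>

definition nonpower_weight :: "nat \<Rightarrow> 'a \<Rightarrow> complex" where
  "nonpower_weight t x = 1 - (\<Sum>b=1..<t. chi b t x) / of_nat (t - 1)"

text \<open>Orthogonality for the \<open>t\<close> characters whose order divides
  \<open>t\<close>.\<close>

lemma sum_chi_numerators:
  assumes "t dvd CARD('a) - 1" "x \<noteq> 0"
  shows "(\<Sum>b<t. chi b t x) = (if is_nth_power t x then of_nat t else 0)"
proof -
  obtain i where i: "x = g ^ i"
    using assms generates by blast
  have "t > 0"
    using assms card_minus_1_pos by (metis dvd_pos_nat)
  then show ?thesis
    using assms by (simp add: i chi_generator_power sum_unity_root_powers is_nth_power_generator_iff)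
qed

lemma nonpower_weight_eq:
  assumes "t dvd CARD('a) - 1" "x \<noteq> 0" "t > 1"
  shows "nonpower_weight t x = (if is_nth_power t x then 0 else 1 / of_real (1 - 1 / real t))"
proof -
  have "{..<t} = insert 0 {1..<t}"
    using assms by auto
  then have "(\<Sum>b<t. chi b t x) = chi 0 t x + (\<Sum>b=1..<t. chi b t x)"
    by simp
  moreover have "chi 0 t x = 1"
    by (simp add: chi_def unity_root_def)
  ultimately have "(\<Sum>b=1..<t. chi b t x) = (if is_nth_power t x then of_nat t else 0) - 1"
    using sum_chi_numerators[OF assms(1,2)] by (simp add: algebra_simps)
  \<comment> \<open>On t-th powers the nontrivial characters sum to t - 1 and the weight vanishes;
    elsewhere they sum to -1 and it is 1 + 1/(t - 1) = 1/(1 - 1/t).\<close>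
  then show ?thesis
    using assms by (simp add: nonpower_weight_def of_nat_diff field_simps)
qed

text \<open>For x = g^i everything depends on i mod 4, and only the residue 2 gives a nonzero value,
  namely 4.\<close>

lemma square_nonfourth_weight_eq:
  assumes "4 dvd CARD('a) - 1" "x \<noteq> 0"
  shows "1 + chi 1 2 x - chi 1 4 x - chi 3 4 x =
    (if is_nth_power 2 x \<and> \<not> is_nth_power 4 x then 4 else 0)"
proof -
  have "2 dvd CARD('a) - 1"
    using assms(1) by (meson dvd_trans even_numeral)
  obtain i where i: "x = g ^ i"
    using assms generates by blast
  have r: "unity_root 1 2 = -1" "unity_root 1 4 = \<i>" "unity_root 3 4 = - \<i>"
  proof -
    have "unity_root 3 4 = unity_root 1 4 ^ 3"
      by (simp add: unity_root_power)
    moreover show "unity_root 1 4 = \<i>"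
      by (simp add: unity_root_def)
    ultimately show "unity_root 3 4 = - \<i>"
      by (simp add: power3_eq_cube)
    show "unity_root 1 2 = -1"
      by (simp add: unity_root_def)
  qed
  have "1 + (-1) ^ i - \<i> ^ i - (- \<i>) ^ i = (if 2 dvd i \<and> \<not> 4 dvd i then 4 else 0)"
  proof -
    define n where "n = i div 4"
    have i4: "i = 4 * n + i mod 4"
      by (simp add: n_def)
    have p4: "\<i> ^ 4 = 1" "(- \<i>) ^ 4 = 1"
      by (simp_all add: power4_eq_xxxx)
    have "i mod 4 < 4"
      by simp
    then consider "i = 4 * n" | "i = 4 * n + 1" | "i = 4 * n + 2" | "i = 4 * n + 3"
      using i4 by linarith
    then show ?thesis
    proof cases
      case 3
      then have "2 dvd i" "\<not> 4 dvd i"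
        by presburger+
      then show ?thesis
        using 3 p4 by (simp add: power_add power_mult)
    next
      case 2
      then have "\<not> 2 dvd i"
        by presburger
      then show ?thesis
        using 2 p4 by (simp add: power_add power_mult)
    next
      case 4
      then have "\<not> 2 dvd i"
        by presburger
      then show ?thesis
        using 4 p4 by (simp add: power_add power_mult power3_eq_cube)
    qed (use p4 in \<open>simp add: power_add power_mult\<close>)
  qed
  then show ?thesis
    using assms \<open>2 dvd CARD('a) - 1\<close>
    by (simp add: i chi_generator_power is_nth_power_generator_iff r del: One_nat_def)
qed

text \<open>Replacing x by c x permutes the terms and multiplies the sum by
  \<open>chi a d c\<close>, which is not 1.\<close>

lemma sum_chi_subfield_eq_0:
  assumes "is_subfield K" "d dvd CARD('a) - 1" "c \<in> K" "c \<noteq> 0" "chi a d c \<noteq> 1"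
  shows "(\<Sum>x\<in>K - {0}. chi a d x) = 0"
proof -
  have "(\<Sum>x\<in>K - {0}. chi a d x) = (\<Sum>x\<in>K - {0}. chi a d (c * x))"
    by (rule sum.reindex_bij_witness[of _ "\<lambda>y. c * y" "\<lambda>y. inverse c * y"])
      (use assms in \<open>auto simp: is_subfield_def mult.assoc[symmetric]\<close>)
  also have "\<dots> = chi a d c * (\<Sum>x\<in>K - {0}. chi a d x)"
    using assms(2,4) by (simp add: chi_mult sum_distrib_left del: One_nat_def)
  finally show ?thesis
    using assms(5) by (simp add: mult_cancel_right1)
qed

end

section \<open>Character sums over an affine line\<close>

locale affine_line = unit_generator g for g :: "'a::{field,finite}" +
  fixes F :: "'a set" and \<theta>1 \<theta>2 :: 'a and q :: nat
  assumes card_UNIV: "CARD('a) = q\<^sup>2"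
    and odd_q: "odd q"
    and subfield: "is_subfield F"
    and card_F: "card F = q"
    and indep: "\<lbrakk>a \<in> F; b \<in> F; a * \<theta>1 + b * \<theta>2 = 0\<rbrakk> \<Longrightarrow> a = 0 \<and> b = 0"
begin

definition pt :: "'a \<Rightarrow> 'a" where
  "pt \<alpha> = \<theta>1 + \<alpha> * \<theta>2"

lemma F_closed:
  "0 \<in> F" "1 \<in> F" "x \<in> F \<Longrightarrow> y \<in> F \<Longrightarrow> x + y \<in> F" "x \<in> F \<Longrightarrow> - x \<in> F"
  "x \<in> F \<Longrightarrow> y \<in> F \<Longrightarrow> x - y \<in> F"
  "x \<in> F \<Longrightarrow> y \<in> F \<Longrightarrow> x * y \<in> F" "x \<in> F \<Longrightarrow> y \<in> F \<Longrightarrow> x / y \<in> F"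
proof -
  show *: "0 \<in> F" "1 \<in> F" "x \<in> F \<Longrightarrow> y \<in> F \<Longrightarrow> x + y \<in> F" "x \<in> F \<Longrightarrow> - x \<in> F"
    "x \<in> F \<Longrightarrow> y \<in> F \<Longrightarrow> x * y \<in> F" for x y
    using subfield by (auto simp: is_subfield_def)
  show "x \<in> F \<Longrightarrow> y \<in> F \<Longrightarrow> x - y \<in> F"
    using *(3)[of x "- y"] *(4)[of y] by simp
  show "x \<in> F \<Longrightarrow> y \<in> F \<Longrightarrow> x / y \<in> F"
    using *(1) *(5)[of x "inverse y"] subfield
    by (cases "y = 0") (auto simp: is_subfield_def divide_inverse)
qed

lemma pt_nonzero:
  assumes "\<alpha> \<in> F"
  shows "pt \<alpha> \<noteq> 0"
  using indep[of 1 \<alpha>] assms by (auto simp: pt_def F_closed)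

lemma q_ge_3: "q \<ge> 3"
proof -
  have "card {0, 1 :: 'a} \<le> card F"
    by (rule card_mono) (auto simp: F_closed)
  then have "q \<ge> 2"
    by (simp add: card_F)
  with odd_q show ?thesis
    by (cases "q = 2") auto
qed

lemma card_minus_1_eq: "CARD('a) - 1 = (q - 1) * (q + 1)"
  by (simp add: card_UNIV power2_eq_square algebra_simps)

lemma four_dvd: "4 dvd CARD('a) - 1"
proof -
  have "even (q - 1)" "even (q + 1)"
    using odd_q q_ge_3 by auto
  then have "2 * 2 dvd (q - 1) * (q + 1)"
    by (rule mult_dvd_mono)
  then show ?thesis
    unfolding card_minus_1_eq by simp
qed

text \<open>If g^i lies in \<open>F\<close>, its (q-1)-th power is 1; cancelling q - 1 in the
  exponents shows that q + 1 divides i.\<close>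

lemma chi_subfield_eq_1:
  assumes "d dvd q + 1" "x \<in> F" "x \<noteq> 0"
  shows "chi a d x = 1"
proof -
  obtain i where i: "x = g ^ i"
    using assms generates by blast
  have "x ^ (q - 1) = 1"
    using subfield_power_card_minus_1[OF subfield] assms by (simp add: card_F)
  then have "g ^ (i * (q - 1)) = g ^ 0"
    by (simp add: i power_mult)
  then have "(q - 1) * (q + 1) dvd i * (q - 1)"
    by (simp only: generator_power_eq_iff card_minus_1_eq cong_0_iff)
  then have "(q - 1) * (q + 1) dvd (q - 1) * i"
    by (simp only: mult.commute)
  then have "q + 1 dvd i"
    by (rule iffD1[OF nat_mult_dvd_cancel1, rotated]) (use q_ge_3 in simp)
  then have "d dvd i"
    using assms(1) dvd_trans by blast
  moreover have "d > 0"
    using assms(1) by (metis add_gr_0 dvd_pos_nat zero_less_one)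
  moreover have "d dvd CARD('a) - 1"
    using assms(1) by (simp add: card_minus_1_eq del: One_nat_def)
  ultimately show ?thesis
    by (simp add: i chi_generator_power unity_root_power unity_root_eq_1_iff del: One_nat_def)
qed

definition char_sum :: "nat \<Rightarrow> nat \<Rightarrow> complex" where
  "char_sum a d = (\<Sum>\<alpha>\<in>F. chi a d (pt \<alpha>))"

lemma bij_betw_ratios:
  "bij_betw (\<lambda>(\<alpha>, \<gamma>). pt \<alpha> / pt \<gamma>) {(\<alpha>, \<gamma>) \<in> F \<times> F. \<alpha> \<noteq> \<gamma>} (UNIV - F)"
proof -
  let ?D = "{(\<alpha>, \<gamma>) \<in> F \<times> F. \<alpha> \<noteq> \<gamma>}"
  let ?f = "\<lambda>(\<alpha>, \<gamma>). pt \<alpha> / pt \<gamma>"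
  have notin: "pt \<alpha> / pt \<gamma> \<notin> F" if "\<alpha> \<in> F" "\<gamma> \<in> F" "\<alpha> \<noteq> \<gamma>" for \<alpha> \<gamma>
  proof
    define t where "t = pt \<alpha> / pt \<gamma>"
    assume "pt \<alpha> / pt \<gamma> \<in> F"
    then have t: "t \<in> F"
      by (simp add: t_def)
    have "pt \<alpha> = t * pt \<gamma>"
      using pt_nonzero[OF that(2)] by (simp add: t_def)
    \<comment> \<open>A ratio in \<open>F\<close> would give a linear relation over
      \<open>F\<close>, forcing t = 1 and hence equal parameters.\<close>
    then have "(1 - t) * \<theta>1 + (\<alpha> - t * \<gamma>) * \<theta>2 = 0"
      by (simp add: pt_def algebra_simps)
    then have "1 - t = 0 \<and> \<alpha> - t * \<gamma> = 0"
      using t that by (intro indep F_closed)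
    with that(3) show False
      by auto
  qed
  have \<theta>2: "\<theta>2 \<noteq> 0"
    using indep[of 0 1] by (auto simp: F_closed)
  have inj: "inj_on ?f ?D"
  proof (rule inj_onI; clarify)
    fix \<alpha> \<gamma> \<alpha>' \<gamma>'
    assume *: "\<alpha> \<in> F" "\<gamma> \<in> F" "\<alpha> \<noteq> \<gamma>" "\<alpha>' \<in> F" "\<gamma>' \<in> F" "\<alpha>' \<noteq> \<gamma>'"
      and eq: "pt \<alpha> / pt \<gamma> = pt \<alpha>' / pt \<gamma>'"
    define t where "t = pt \<alpha> / pt \<gamma>"
    have t: "t \<notin> F"
      using notin * by (simp add: t_def)
    have "pt \<alpha> = t * pt \<gamma>" "pt \<alpha>' = t * pt \<gamma>'"
      using pt_nonzero * eq unfolding t_def by (metis nonzero_divide_eq_eq)+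
    then have "pt \<alpha> - pt \<alpha>' = t * (pt \<gamma> - pt \<gamma>')"
      by (simp add: algebra_simps)
    then have "(\<alpha> - \<alpha>') * \<theta>2 = (t * (\<gamma> - \<gamma>')) * \<theta>2"
      by (simp add: pt_def algebra_simps)
    then have diff: "\<alpha> - \<alpha>' = t * (\<gamma> - \<gamma>')"
      using \<theta>2 by simp
    have "\<gamma> = \<gamma>'"
    proof (rule ccontr)
      assume "\<gamma> \<noteq> \<gamma>'"
      then have "t = (\<alpha> - \<alpha>') / (\<gamma> - \<gamma>')"
        using diff by simp
      then show False
        using t * by (simp add: F_closed)
    qed
    with diff show "\<alpha> = \<alpha>' \<and> \<gamma> = \<gamma>'"
      by simp
  qed
  \<comment> \<open>Surjectivity by counting: there are q^2 - q ordered pairs and equally many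
    elements outside \<open>F\<close>.\<close>
  have "card ?D = card (F \<times> F - (\<lambda>\<alpha>. (\<alpha>, \<alpha>)) ` F)"
    by (rule arg_cong[of _ _ card]) auto
  also have "\<dots> = q\<^sup>2 - q"
    by (subst card_Diff_subset)
      (auto simp: card_image inj_on_def card_F card_cartesian_product power2_eq_square)
  also have "\<dots> = card (UNIV - F)"
    by (simp add: card_Diff_subset card_UNIV card_F)
  finally have "card (?f ` ?D) = card (UNIV - F)"
    using inj by (simp add: card_image)
  then have "?f ` ?D = UNIV - F"
    using notin by (intro card_subset_eq) auto
  with inj show ?thesis
    by (simp add: bij_betw_def)
qed

text \<open>In the double sum for the squared modulus the diagonal contributes q, and the other
  ratios run once through the complement of \<open>F\<close>.\<close>

lemma norm_char_sum_square:
  assumes "d dvd CARD('a) - 1"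
  shows "complex_of_real ((cmod (char_sum a d))\<^sup>2) = of_nat q + (\<Sum>x\<in>UNIV - F. chi a d x)"
proof -
  let ?D = "{(\<alpha>, \<gamma>) \<in> F \<times> F. \<alpha> \<noteq> \<gamma>}"
  let ?I = "(\<lambda>\<alpha>. (\<alpha>, \<alpha>)) ` F"
  let ?h = "\<lambda>(\<alpha>, \<gamma>). chi a d (pt \<alpha> / pt \<gamma>)"
  have "complex_of_real ((cmod (char_sum a d))\<^sup>2) = char_sum a d * cnj (char_sum a d)"
    by (rule complex_norm_square)
  also have "\<dots> = (\<Sum>\<alpha>\<in>F. \<Sum>\<gamma>\<in>F. chi a d (pt \<alpha>) * cnj (chi a d (pt \<gamma>)))"
    by (simp add: char_sum_def sum_product)
  also have "\<dots> = (\<Sum>\<alpha>\<in>F. \<Sum>\<gamma>\<in>F. chi a d (pt \<alpha> / pt \<gamma>))"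
    using assms by (intro sum.cong refl) (simp add: chi_divide pt_nonzero)
  also have "\<dots> = sum ?h (F \<times> F)"
    by (simp add: sum.cartesian_product)
  also have "F \<times> F = ?I \<union> ?D"
    by auto
  also have "sum ?h (?I \<union> ?D) = sum ?h ?I + sum ?h ?D"
    by (rule sum.union_disjoint) auto
  also have "sum ?h ?I = of_nat q"
  proof -
    have "chi a d 1 = 1"
      using chi_generator_power[OF assms, of a 0] by simp
    then have "sum ?h ?I = (\<Sum>\<alpha>\<in>F. 1)"
      by (subst sum.reindex) (auto simp: inj_on_def pt_nonzero intro!: sum.cong)
    then show ?thesis
      by (simp add: card_F)
  qed
  also have "sum ?h ?D = (\<Sum>x\<in>UNIV - F. chi a d x)"
    using sum.reindex_bij_betw[OF bij_betw_ratios, of "chi a d"]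
    by (simp add: case_prod_unfold)
  finally show ?thesis .
qed

definition bound :: "nat \<Rightarrow> real" where
  "bound d = (if d dvd q + 1 then 1 else sqrt (real q))"

text \<open>The sum over all units vanishes, so the sum outside \<open>F\<close> is minus the sum
  over the units of \<open>F\<close>. The latter is q - 1 or 0, making the squared modulus 1 or
  q.\<close>

lemma norm_char_sum_le:
  assumes d: "d dvd CARD('a) - 1" "d \<noteq> 1" and coprime: "coprime a d"
  shows "cmod (char_sum a d) \<le> bound d"
proof -
  have "\<not> d dvd a"
    using d(2) coprime by (metis coprime_absorb_right coprime_commute is_unit_gcd nat_dvd_1_iff_1)
  moreover have "d > 0"
    using d(1) card_minus_1_pos by (metis dvd_pos_nat)
  ultimately have "chi a d g \<noteq> 1"
    using chi_generator_power[OF d(1), of a 1] by (simp add: unity_root_eq_1_iff)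
  then have "(\<Sum>x\<in>UNIV - {0}. chi a d x) = 0"
    using d(1) generator_nonzero by (intro sum_chi_subfield_eq_0[of UNIV _ g]) auto
  moreover have "(\<Sum>x\<in>UNIV - {0}. chi a d x) =
      (\<Sum>x\<in>UNIV - F. chi a d x) + (\<Sum>x\<in>F - {0}. chi a d x)"
    by (subst sum.union_disjoint[symmetric]) (auto intro!: sum.cong F_closed)
  ultimately have sq: "complex_of_real ((cmod (char_sum a d))\<^sup>2) =
      of_nat q - (\<Sum>x\<in>F - {0}. chi a d x)"
    unfolding norm_char_sum_square[OF d(1)] by (simp add: add_eq_0_iff)
  show ?thesis
  proof (cases "\<forall>x\<in>F - {0}. chi a d x = 1")
    case True
    then have "(\<Sum>x\<in>F - {0}. chi a d x) = of_nat (q - 1)"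
      by (simp add: card_Diff_singleton F_closed card_F)
    with sq have "complex_of_real ((cmod (char_sum a d))\<^sup>2) = complex_of_real 1"
      using q_ge_3 by (simp add: of_nat_diff)
    then have "(cmod (char_sum a d))\<^sup>2 = 1"
      by (simp only: of_real_eq_iff)
    then have "cmod (char_sum a d) = 1"
      by (simp add: power2_eq_1_iff) (use norm_ge_zero[of "char_sum a d"] in linarith)
    then show ?thesis
      using q_ge_3 by (simp add: bound_def)
  next
    case False
    then have "\<not> d dvd q + 1"
      using chi_subfield_eq_1 by blast
    moreover have "(\<Sum>x\<in>F - {0}. chi a d x) = 0"
      using False sum_chi_subfield_eq_0[OF subfield d(1)] by blast
    then have "complex_of_real ((cmod (char_sum a d))\<^sup>2) = complex_of_real (real q)"
      using sq by simp
    then have "(cmod (char_sum a d))\<^sup>2 = real q"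
      by (simp only: of_real_eq_iff)
    then have "cmod (char_sum a d) = sqrt (real q)"
      by (metis norm_ge_zero real_sqrt_unique)
    ultimately show ?thesis
      by (simp add: bound_def)
  qed
qed

section \<open>The sieve\<close>

text \<open>The twist by \<open>chi a d\<close> makes recursion on \<open>P\<close> possible:
  expanding one weight only changes this character.\<close>

definition sieve_sum :: "nat set \<Rightarrow> nat \<Rightarrow> nat \<Rightarrow> complex" where
  "sieve_sum P a d = (\<Sum>\<alpha>\<in>F. chi a d (pt \<alpha>) * (\<Prod>t\<in>P. nonpower_weight t (pt \<alpha>)))"

text \<open>The closed form of the sum of \<^term>\<open>bound (d * \<Prod>D)\<close> over the subsets \<open>D\<close> of \<open>P\<close>.\<close>

definition sieve_bound :: "nat set \<Rightarrow> nat \<Rightarrow> real" where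
  "sieve_bound P d = 2 ^ card P * sqrt (real q)
     - (if d dvd q + 1 then 2 ^ card {t \<in> P. t dvd q + 1} * (sqrt (real q) - 1) else 0)"

text \<open>The weight of \<open>t\<close> is 1 minus an average of characters of denominator
  \<open>t\<close>; each of them merges with \<open>chi a d\<close> into a character of denominator
  \<open>d * t\<close>.\<close>

lemma sieve_sum_insert:
  assumes "finite P" "t \<notin> P" "t dvd CARD('a) - 1" "d dvd CARD('a) - 1" "coprime d t"
  shows "sieve_sum (insert t P) a d =
    sieve_sum P a d - (\<Sum>b=1..<t. sieve_sum P (a * t + b * d) (d * t)) / of_nat (t - 1)"
proof -
  let ?w = "\<lambda>\<alpha>. \<Prod>t\<in>P. nonpower_weight t (pt \<alpha>)"
  have "sieve_sum (insert t P) a d = (\<Sum>\<alpha>\<in>F. chi a d (pt \<alpha>) * ?w \<alpha> -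
      (\<Sum>b=1..<t. chi (a * t + b * d) (d * t) (pt \<alpha>) * ?w \<alpha>) / of_nat (t - 1))"
    unfolding sieve_sum_def
  proof (rule sum.cong)
    fix \<alpha> assume "\<alpha> \<in> F"
    then have "chi (a * t + b * d) (d * t) (pt \<alpha>) = chi a d (pt \<alpha>) * chi b t (pt \<alpha>)" for b
      using chi_coprime_mult[OF assms(4,3) _ assms(5)] pt_nonzero by simp
    then have "(\<Sum>b=1..<t. chi (a * t + b * d) (d * t) (pt \<alpha>) * ?w \<alpha>) =
        chi a d (pt \<alpha>) * ?w \<alpha> * (\<Sum>b=1..<t. chi b t (pt \<alpha>))"
      by (simp add: sum_distrib_left mult_ac)
    then show "chi a d (pt \<alpha>) * (\<Prod>t\<in>insert t P. nonpower_weight t (pt \<alpha>)) =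
        chi a d (pt \<alpha>) * ?w \<alpha> -
        (\<Sum>b=1..<t. chi (a * t + b * d) (d * t) (pt \<alpha>) * ?w \<alpha>) / of_nat (t - 1)"
      using assms(1,2) by (simp add: nonpower_weight_def[of t] algebra_simps)
  qed simp
  also have "\<dots> = sieve_sum P a d -
      (\<Sum>b=1..<t. sieve_sum P (a * t + b * d) (d * t)) / of_nat (t - 1)"
    unfolding sieve_sum_def
    by (subst sum.swap) (simp add: sum_subtractf sum_divide_distrib)
  finally show ?thesis .
qed

text \<open>The two summands stand for the subsets avoiding \<open>t\<close> and those containing
  \<open>t\<close>.\<close>

lemma sieve_bound_insert:
  assumes "finite P" "t \<notin> P" "coprime d t"
  shows "sieve_bound (insert t P) d = sieve_bound P d + sieve_bound P (d * t)"
proof -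
  have "d * t dvd q + 1 \<longleftrightarrow> d dvd q + 1 \<and> t dvd q + 1"
    using assms(3) by (auto intro: divides_mult dvd_mult_left dvd_mult_right)
  moreover have "card {s \<in> insert t P. s dvd q + 1} =
      (if t dvd q + 1 then Suc (card {s \<in> P. s dvd q + 1}) else card {s \<in> P. s dvd q + 1})"
  proof (cases "t dvd q + 1")
    case True
    then have "{s \<in> insert t P. s dvd q + 1} = insert t {s \<in> P. s dvd q + 1}"
      by auto
    with True assms(1,2) show ?thesis
      by simp
  next
    case False
    then have "{s \<in> insert t P. s dvd q + 1} = {s \<in> P. s dvd q + 1}"
      by auto
    with False show ?thesis
      by simp
  qed
  ultimately show ?thesis
    using assms(1,2) unfolding sieve_bound_def by (auto simp: algebra_simps)
qed

text \<open>The difference is an average over exactly t - 1 twisted sums, so their common bound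
  passes to it without an extra factor.\<close>

lemma norm_sieve_sum_insert_diff_le:
  assumes "finite P" "t \<notin> P" "t dvd CARD('a) - 1" "d dvd CARD('a) - 1" "coprime d t"
    and "prime t" "coprime a d" "\<And>c. coprime c (d * t) \<Longrightarrow> cmod (sieve_sum P c (d * t)) \<le> B"
  shows "cmod (sieve_sum (insert t P) a d - sieve_sum P a d) \<le> B"
proof -
  have "cmod (sieve_sum P (a * t + b * d) (d * t)) \<le> B" if "b \<in> {1..<t}" for b
  proof -
    have "\<not> t dvd b"
      using that by (auto dest: dvd_imp_le)
    then have "coprime b t"
      using assms(6) by (metis coprime_commute prime_imp_coprime_nat)
    then show ?thesis
      using assms by (intro assms(8) coprime_combination)
  qed
  then have "cmod ((\<Sum>b=1..<t. sieve_sum P (a * t + b * d) (d * t)) / of_nat (t - 1)) \<le> B"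
    using prime_gt_1_nat[OF assms(6)] by (rule norm_average_le)
  then show ?thesis
    unfolding sieve_sum_insert[OF assms(1-5)] by (simp add: norm_minus_commute)
qed

text \<open>The main term is \<open>q + 1\<close> rather than the value \<open>q\<close> of the trivial character sum, so that
  the trivial character contributes an error of exactly 1, like every other character that is
  trivial on \<open>F\<close>.\<close>

lemma norm_sieve_sum_le:
  assumes "finite P" "\<And>t. t \<in> P \<Longrightarrow> prime t \<and> t dvd CARD('a) - 1 \<and> coprime d t"
    "d dvd CARD('a) - 1" "coprime a d"
  shows "cmod (sieve_sum P a d - (if d = 1 then of_nat (q + 1) else 0)) \<le> sieve_bound P d"
  using assms
proof (induction P arbitrary: a d rule: finite_induct)
  case empty
  have sum: "sieve_sum {} a d = char_sum a d"
    by (simp add: sieve_sum_def char_sum_def)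
  have bd: "sieve_bound {} d = bound d"
    by (simp add: sieve_bound_def bound_def)
  show ?case
  proof (cases "d = 1")
    case True
    then have "char_sum a d = of_nat q"
      using chi_trivial by (simp add: char_sum_def card_F)
    then show ?thesis
      unfolding sum bd using True by (simp add: bound_def)
  next
    case False
    then show ?thesis
      unfolding sum bd using norm_char_sum_le empty by simp
  qed
next
  case (insert t P)
  have t: "prime t" "t dvd CARD('a) - 1" "coprime d t"
    using insert.prems(1) by auto
  have dt: "d * t dvd CARD('a) - 1"
    using t insert.prems(2) by (simp add: divides_mult)
  \<comment> \<open>A twist whose order is divisible by \<open>t\<close> is never trivial, so these
    sums have no main term.\<close>
  have t1: "d * t \<noteq> 1"
    using t(1) by auto
  have "cmod (sieve_sum P c (d * t)) \<le> sieve_bound P (d * t)" if "coprime c (d * t)" for c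
  proof -
    have "prime u \<and> u dvd CARD('a) - 1 \<and> coprime (d * t) u" if "u \<in> P" for u
      using insert.prems(1)[of u] that t(1) insert.hyps(2) by (auto intro: primes_coprime)
    then show ?thesis
      using insert.IH[of "d * t" c] dt that unfolding if_not_P[OF t1] by simp
  qed
  then have "cmod (sieve_sum (insert t P) a d - sieve_sum P a d) \<le> sieve_bound P (d * t)"
    using t insert.hyps insert.prems by (intro norm_sieve_sum_insert_diff_le)
  moreover have "cmod (sieve_sum P a d - (if d = 1 then of_nat (q + 1) else 0)) \<le> sieve_bound P d"
    using insert.prems by (intro insert.IH) auto
  moreover have "cmod (x - z) \<le> cmod (x - y) + cmod (y - z)" for x y z
    using norm_triangle_ineq[of "x - y" "y - z"] by simp
  ultimately show ?case
    unfolding sieve_bound_insert[OF insert.hyps t(3)] by (smt (verit))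
qed

section \<open>Counting points and the sieve inequality\<close>

definition sieved_set :: "nat set \<Rightarrow> 'a set" where
  "sieved_set P = {\<alpha> \<in> F. (\<forall>t\<in>P. \<not> is_nth_power t (pt \<alpha>)) \<and>
     is_nth_power 2 (pt \<alpha>) \<and> \<not> is_nth_power 4 (pt \<alpha>)}"

text \<open>For a set of primes with product m this is phi(m)/m, the factor divided out by
  \<open>nonpower_weight\<close>.\<close>

definition density :: "nat set \<Rightarrow> real" where
  "density P = (\<Prod>t\<in>P. 1 - 1 / real t)"

text \<open>The four twists come from expanding 1 + chi^2 - chi - chi^3; the pair (0, 1) encodes the
  trivial character.\<close>

definition combined_sum :: "nat set \<Rightarrow> complex" where
  "combined_sum P = sieve_sum P 0 1 + sieve_sum P 1 2 - sieve_sum P 1 4 - sieve_sum P 3 4"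

lemma combined_sum_eq:
  assumes "finite P" "\<And>t. t \<in> P \<Longrightarrow> prime t \<and> t dvd CARD('a) - 1"
  shows "combined_sum P = of_real (4 * real (card (sieved_set P)) / density P)"
proof -
  have "combined_sum P = (\<Sum>\<alpha>\<in>F.
      (1 + chi 1 2 (pt \<alpha>) - chi 1 4 (pt \<alpha>) - chi 3 4 (pt \<alpha>)) *
      (\<Prod>t\<in>P. nonpower_weight t (pt \<alpha>)))"
    unfolding combined_sum_def sieve_sum_def chi_trivial
    by (simp add: algebra_simps sum.distrib sum_subtractf)
  also have "\<dots> = (\<Sum>\<alpha>\<in>F. if \<alpha> \<in> sieved_set P then of_real (4 / density P) else 0)"
  proof (rule sum.cong)
    fix \<alpha> assume \<alpha>: "\<alpha> \<in> F"
    have w: "nonpower_weight t (pt \<alpha>) =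
        (if is_nth_power t (pt \<alpha>) then 0 else 1 / of_real (1 - 1 / real t))" if "t \<in> P" for t
      using assms(2)[OF that] pt_nonzero[OF \<alpha>] by (intro nonpower_weight_eq prime_gt_1_nat) auto
    have prod: "(\<Prod>t\<in>P. nonpower_weight t (pt \<alpha>)) =
        (if \<forall>t\<in>P. \<not> is_nth_power t (pt \<alpha>) then 1 / of_real (density P) else 0)"
    proof (cases "\<forall>t\<in>P. \<not> is_nth_power t (pt \<alpha>)")
      case True
      then have "(\<Prod>t\<in>P. nonpower_weight t (pt \<alpha>)) = (\<Prod>t\<in>P. 1 / of_real (1 - 1 / real t))"
        using w by (intro prod.cong) auto
      then show ?thesis
        using True by (simp add: density_def prod_dividef)
    next
      case False
      then have "\<exists>t\<in>P. nonpower_weight t (pt \<alpha>) = 0"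
        using w by auto
      then show ?thesis
        using False assms(1) by (auto simp: prod_zero)
    qed
    show "(1 + chi 1 2 (pt \<alpha>) - chi 1 4 (pt \<alpha>) - chi 3 4 (pt \<alpha>)) *
        (\<Prod>t\<in>P. nonpower_weight t (pt \<alpha>)) =
        (if \<alpha> \<in> sieved_set P then of_real (4 / density P) else 0)"
      unfolding prod square_nonfourth_weight_eq[OF four_dvd pt_nonzero[OF \<alpha>]]
      using \<alpha> by (auto simp: sieved_set_def)
  qed simp
  also have "\<dots> = (\<Sum>\<alpha>\<in>sieved_set P. of_real (4 / density P))"
    by (rule sum.mono_neutral_cong_right) (auto simp: sieved_set_def)
  finally show ?thesis
    by simp
qed

text \<open>The factor \<open>d\<close> is 1 when a count is estimated, and a prime \<open>t\<close>
  when the effect of adding \<open>t\<close> is estimated.\<close>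

definition combined_bound :: "nat set \<Rightarrow> nat \<Rightarrow> real" where
  "combined_bound P d = sieve_bound P d + sieve_bound P (2 * d) + 2 * sieve_bound P (4 * d)"

text \<open>Only the untwisted sum carries the main term; the other three are pure error.\<close>

lemma norm_combined_sum_le:
  assumes "finite P" "\<And>t. t \<in> P \<Longrightarrow> prime t \<and> odd t \<and> t dvd CARD('a) - 1"
  shows "cmod (combined_sum P - of_nat (q + 1)) \<le> combined_bound P 1"
proof -
  have two: "2 dvd CARD('a) - 1"
    using four_dvd by (meson dvd_trans even_numeral)
  have cop: "coprime 2 t" "coprime 4 t" if "t \<in> P" for t
    using assms(2)[OF that] coprime_power_left_iff[of 2 2 t] by auto
  have "coprime 3 (4::nat)"
    by (simp add: coprime_iff_gcd_eq_1 gcd_non_0_nat)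
  then have "cmod ((sieve_sum P 0 1 - of_nat (q + 1)) + sieve_sum P 1 2 - sieve_sum P 1 4 - sieve_sum P 3 4)
      \<le> sieve_bound P 1 + sieve_bound P 2 + 2 * sieve_bound P 4"
    using norm_sieve_sum_le[of P 1 0] norm_sieve_sum_le[of P 2 1]
      norm_sieve_sum_le[of P 4 1] norm_sieve_sum_le[of P 4 3] assms two four_dvd cop
    by (intro norm_combination_le) auto
  moreover have "combined_bound P 1 = sieve_bound P 1 + sieve_bound P 2 + 2 * sieve_bound P 4"
    by (simp only: combined_bound_def mult_1_right)
  ultimately show ?thesis
    by (simp add: combined_sum_def algebra_simps)
qed

text \<open>The main terms cancel in the difference, leaving only characters of order divisible by
  \<open>t\<close>.\<close>

lemma norm_combined_sum_insert_le:
  assumes "finite P" "\<And>u. u \<in> insert t P \<Longrightarrow> prime u \<and> odd u \<and> u dvd CARD('a) - 1" "t \<notin> P"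
  shows "cmod (combined_sum (insert t P) - combined_sum P) \<le> combined_bound P t"
proof -
  have t: "prime t" "odd t" "t dvd CARD('a) - 1"
    using assms(2) by auto
  have P: "prime u \<and> u dvd CARD('a) - 1" if "u \<in> P" for u
    using assms(2) that by auto
  have two: "2 dvd CARD('a) - 1"
    using four_dvd by (meson dvd_trans even_numeral)
  have cop: "coprime 2 u" "coprime 4 u" if "odd u" for u :: nat
    using that coprime_power_left_iff[of 2 2 u] by auto
  have copt: "coprime t u" if "u \<in> P" for u
    using t(1) P[OF that] assms(3) that by (auto intro: primes_coprime)
  have diff: "cmod (sieve_sum (insert t P) a d - sieve_sum P a d) \<le> sieve_bound P (d * t)"
    if d: "d \<in> {1, 2, 4}" and a: "coprime a d" for a d
  proof -
    have dN: "d dvd CARD('a) - 1"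
      using d two four_dvd by auto
    have odd_cop: "coprime d u" if "odd u" for u
      using d cop[OF that] by auto
    have dt: "d * t dvd CARD('a) - 1" "d * t \<noteq> 1"
      using dN t odd_cop[OF t(2)] by (auto simp: divides_mult)
    have "prime u \<and> u dvd CARD('a) - 1 \<and> coprime (d * t) u" if "u \<in> P" for u
      using assms(2)[of u] that odd_cop copt by auto
    then have "cmod (sieve_sum P c (d * t)) \<le> sieve_bound P (d * t)" if "coprime c (d * t)" for c
      using norm_sieve_sum_le[OF assms(1) _ dt(1) that] unfolding if_not_P[OF dt(2)] by simp
    then show ?thesis
      using assms(1,3) t dN odd_cop[OF t(2)] a by (intro norm_sieve_sum_insert_diff_le)
  qed
  have "coprime 3 (4::nat)"
    by (simp add: coprime_iff_gcd_eq_1 gcd_non_0_nat)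
  then have "cmod ((sieve_sum (insert t P) 0 1 - sieve_sum P 0 1)
      + (sieve_sum (insert t P) 1 2 - sieve_sum P 1 2)
      - (sieve_sum (insert t P) 1 4 - sieve_sum P 1 4)
      - (sieve_sum (insert t P) 3 4 - sieve_sum P 3 4))
      \<le> sieve_bound P (1 * t) + sieve_bound P (2 * t) + 2 * sieve_bound P (4 * t)"
    by (intro norm_combination_le diff) auto
  then show ?thesis
    by (simp add: combined_sum_def combined_bound_def algebra_simps)
qed

text \<open>Union bound: a point lost in passing from \<open>P\<close> to
  \<open>P \<union> R\<close> is already lost on adding some single t in \<open>R\<close>.\<close>

lemma card_sieved_set_ge:
  assumes "finite R"
  shows "real (card (sieved_set P)) - (\<Sum>t\<in>R. real (card (sieved_set P)) -
      real (card (sieved_set (insert t P)))) \<le> real (card (sieved_set (P \<union> R)))"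
proof -
  have fin: "finite (sieved_set S)" for S
    by (rule finite_subset[of _ UNIV]) auto
  have sub: "sieved_set (S \<union> S') \<subseteq> sieved_set S" for S S'
    by (auto simp: sieved_set_def)
  have sub': "sieved_set (insert t P) \<subseteq> sieved_set P" for t
    using sub[of P "{t}"] by simp
  have "sieved_set P - sieved_set (P \<union> R) \<subseteq> (\<Union>t\<in>R. sieved_set P - sieved_set (insert t P))"
    by (auto simp: sieved_set_def)
  then have "card (sieved_set P - sieved_set (P \<union> R))
      \<le> card (\<Union>t\<in>R. sieved_set P - sieved_set (insert t P))"
    by (intro card_mono) (auto simp: assms fin)
  also have "\<dots> \<le> (\<Sum>t\<in>R. card (sieved_set P - sieved_set (insert t P)))"
    using assms by (rule card_UN_le)
  finally have "real (card (sieved_set P - sieved_set (P \<union> R)))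
      \<le> (\<Sum>t\<in>R. real (card (sieved_set P - sieved_set (insert t P))))"
    by (metis of_nat_le_iff of_nat_sum)
  moreover have "real (card (sieved_set P - sieved_set (P \<union> R))) =
      real (card (sieved_set P)) - real (card (sieved_set (P \<union> R)))"
    using sub fin by (simp add: card_Diff_subset of_nat_diff card_mono)
  moreover have "real (card (sieved_set P - sieved_set (insert t P))) =
      real (card (sieved_set P)) - real (card (sieved_set (insert t P)))" for t
    using sub' fin by (simp add: card_Diff_subset of_nat_diff card_mono)
  ultimately show ?thesis
    by simp
qed

lemma density_pos:
  assumes "\<And>t. t \<in> P \<Longrightarrow> prime t"
  shows "density P > 0"
  unfolding density_def
proof (rule prod_pos)
  fix t assume "t \<in> P"
  then have "t > 1"
    using assms prime_gt_1_nat by blast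
  then show "0 < 1 - 1 / real t"
    by simp
qed

lemma sieved_set_nonempty:
  assumes fin: "finite P" "finite R" and disj: "P \<inter> R = {}"
    and primes: "\<And>t. t \<in> P \<union> R \<Longrightarrow> prime t \<and> odd t \<and> t dvd CARD('a) - 1"
    and \<epsilon>: "\<epsilon> = 1 - (\<Sum>t\<in>R. 1 / real t)" "\<epsilon> > 0"
    and main: "\<epsilon> * combined_bound P 1 + (\<Sum>t\<in>R. (1 - 1 / real t) * combined_bound P t) < \<epsilon> * (real q + 1)"
  shows "sieved_set (P \<union> R) \<noteq> {}"
proof -
  \<comment> \<open>The count normalised to have expected size q + 1; on the sets used here it is
    the real value of \<open>combined_sum\<close>.\<close>
  define v where "v S = 4 * real (card (sieved_set S)) / density S" for S
  let ?\<delta> = "density P"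
  have \<delta>: "?\<delta> > 0"
    using primes by (intro density_pos) auto
  have card: "real (card (sieved_set P)) = ?\<delta> / 4 * v P"
    using \<delta> by (simp add: v_def)
  have "cmod (of_real (v P - (real q + 1))) \<le> combined_bound P 1"
    using norm_combined_sum_le[OF fin(1)] combined_sum_eq[OF fin(1)] primes
    by (simp add: v_def add.commute)
  then have "\<bar>v P - (real q + 1)\<bar> \<le> combined_bound P 1"
    by (simp only: norm_of_real)
  then have v_ge: "v P \<ge> real q + 1 - combined_bound P 1"
    by linarith
  have step: "real (card (sieved_set P)) - real (card (sieved_set (insert t P)))
      \<le> ?\<delta> / 4 * (v P * (1 / real t) + (1 - 1 / real t) * combined_bound P t)" if t: "t \<in> R" for t
  proof -
    have tP: "t \<notin> P"
      using t disj by auto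
    have t1: "t > 1"
      using primes t prime_gt_1_nat by blast
    have dens: "density (insert t P) = (1 - 1 / real t) * ?\<delta>"
      using fin(1) tP by (simp add: density_def)
    have card': "real (card (sieved_set (insert t P))) = ?\<delta> / 4 * ((1 - 1 / real t) * v (insert t P))"
      unfolding v_def dens using \<delta> t1 by (simp add: field_simps)
    have "cmod (combined_sum (insert t P) - combined_sum P) \<le> combined_bound P t"
      using primes t by (intro norm_combined_sum_insert_le fin tP) auto
    moreover have "combined_sum (insert t P) - combined_sum P = of_real (v (insert t P) - v P)"
      unfolding v_def of_real_diff using primes t fin(1)
      by (intro arg_cong2[of _ _ _ _ "(-)"] combined_sum_eq) auto
    ultimately have "\<bar>v (insert t P) - v P\<bar> \<le> combined_bound P t"
      by (simp only: norm_of_real)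
    then have "v (insert t P) \<ge> v P - combined_bound P t"
      by linarith
    then have "(1 - 1 / real t) * v (insert t P) \<ge> (1 - 1 / real t) * (v P - combined_bound P t)"
      using t1 by (intro mult_left_mono) auto
    \<comment> \<open>The loss at \<open>t\<close> splits into the expected share 1/t of
      \<open>v P\<close> and an error damped by 1 - 1/t.\<close>
    then have "v P - (1 - 1 / real t) * v (insert t P) \<le>
        v P * (1 / real t) + (1 - 1 / real t) * combined_bound P t"
      by (simp add: algebra_simps)
    then have "?\<delta> / 4 * (v P - (1 - 1 / real t) * v (insert t P)) \<le>
        ?\<delta> / 4 * (v P * (1 / real t) + (1 - 1 / real t) * combined_bound P t)"
      using \<delta> by (intro mult_left_mono) auto
    then show ?thesis
      unfolding card card' by (simp only: right_diff_distrib)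
  qed
  have "(\<Sum>t\<in>R. real (card (sieved_set P)) - real (card (sieved_set (insert t P))))
      \<le> (\<Sum>t\<in>R. ?\<delta> / 4 * (v P * (1 / real t) + (1 - 1 / real t) * combined_bound P t))"
    by (intro sum_mono step)
  also have "\<dots> = ?\<delta> / 4 * (v P * (\<Sum>t\<in>R. 1 / real t) +
      (\<Sum>t\<in>R. (1 - 1 / real t) * combined_bound P t))"
    by (simp only: sum_distrib_left sum.distrib[symmetric])
  \<comment> \<open>The expected losses add up to (1 - \<open>\<epsilon>\<close>)
    \<open>v P\<close>, so the fraction \<open>\<epsilon>\<close> of \<open>v P\<close>
    survives.\<close>
  finally have "real (card (sieved_set (P \<union> R))) \<ge> ?\<delta> / 4 * v P - ?\<delta> / 4 * (v P * (1 - \<epsilon>) +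
      (\<Sum>t\<in>R. (1 - 1 / real t) * combined_bound P t))"
    using card_sieved_set_ge[OF fin(2), of P] \<epsilon>(1) card by simp
  also have "?\<delta> / 4 * v P - ?\<delta> / 4 * (v P * (1 - \<epsilon>) +
      (\<Sum>t\<in>R. (1 - 1 / real t) * combined_bound P t)) =
      ?\<delta> / 4 * (\<epsilon> * v P - (\<Sum>t\<in>R. (1 - 1 / real t) * combined_bound P t))"
    by (simp add: algebra_simps)
  finally have ge: "real (card (sieved_set (P \<union> R))) \<ge>
      ?\<delta> / 4 * (\<epsilon> * v P - (\<Sum>t\<in>R. (1 - 1 / real t) * combined_bound P t))" .
  have "\<epsilon> * v P \<ge> \<epsilon> * (real q + 1 - combined_bound P 1)"
    using v_ge \<epsilon>(2) by (intro mult_left_mono) auto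
  then have "0 < \<epsilon> * v P - (\<Sum>t\<in>R. (1 - 1 / real t) * combined_bound P t)"
    using main by (simp add: algebra_simps)
  then have "0 < ?\<delta> / 4 * (\<epsilon> * v P - (\<Sum>t\<in>R. (1 - 1 / real t) * combined_bound P t))"
    using \<delta> by (intro mult_pos_pos) auto
  with ge have "card (sieved_set (P \<union> R)) > 0"
    by linarith
  then show ?thesis
    by auto
qed

text \<open>When d divides the even number q + 1, so does 2d, giving savings of multiplicity 2. The
  two characters of order 4 add 2 more exactly when 4 divides q + 1.\<close>

lemma combined_bound_eq:
  assumes "odd d"
  shows "combined_bound P d = 4 * 2 ^ card P * sqrt (real q)
    - (if d dvd q + 1 then (if [q = 3] (mod 4) then 4 else 2) *
        2 ^ card {t \<in> P. t dvd q + 1} * (sqrt (real q) - 1) else 0)"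
proof -
  have cop: "coprime 2 d" "coprime 4 d"
    using assms coprime_power_left_iff[of 2 2 d] by auto
  have two: "2 * d dvd q + 1 \<longleftrightarrow> d dvd q + 1"
    using odd_q cop divides_mult[of 2 "q + 1" d] by (auto intro: dvd_mult_right)
  have "4 dvd q + 1 \<longleftrightarrow> [q = 3] (mod 4)"
    unfolding cong_def by presburger
  then have four: "4 * d dvd q + 1 \<longleftrightarrow> [q = 3] (mod 4) \<and> d dvd q + 1"
    using cop divides_mult[of 4 "q + 1" d] by (metis dvd_mult_left dvd_mult_right)
  show ?thesis
    unfolding combined_bound_def sieve_bound_def two four by (simp add: algebra_simps)
qed

end

section \<open>From the sieve to the stated criteria\<close>

lemma prime_factors_prod_primes:
  assumes "finite (S::nat set)" "\<And>t. t \<in> S \<Longrightarrow> prime t"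
  shows "prime_factors (\<Prod>S) = S"
proof -
  have "0 \<notin> id ` S"
    using assms(2) by fastforce
  then have "prime_factors (prod id S) = (\<Union>t\<in>S. prime_factors t)"
    using assms(1) by (subst prime_factors_prod) auto
  also have "\<dots> = S"
    using assms(2) by (auto simp: prime_prime_factors)
  finally show ?thesis
    by (simp add: id_def)
qed

text \<open>A d-th power with d different from 1 is also a t-th power for any prime t dividing d, so
  testing primes suffices.\<close>

lemma m_freeI:
  fixes \<xi> :: "'a::field"
  assumes "\<xi> \<noteq> 0" "m \<noteq> 0" "\<And>t. t \<in> prime_factors m \<Longrightarrow> \<not> is_nth_power t \<xi>"
  shows "m_free m \<xi>"
  unfolding m_free_def
proof (intro conjI allI impI assms(1))
  fix d \<zeta>
  assume *: "d dvd m \<and> \<zeta> \<noteq> 0 \<and> \<xi> = \<zeta> ^ d"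
  show "d = 1"
  proof (rule ccontr)
    assume "d \<noteq> 1"
    then obtain t where t: "prime t" "t dvd d"
      using prime_factor_nat by blast
    then obtain e where "d = e * t"
      by (metis dvd_div_mult_self)
    then have "is_nth_power t \<xi>"
      using * by (simp add: power_mult)
    moreover have "t \<in> prime_factors m"
      using t * assms(2) by (auto simp: prime_factors_dvd)
    ultimately show False
      using assms(3) by blast
  qed
qed

theorem theorem8p5:
  fixes q l q2 q2' k k1 r s :: nat
    and p :: "nat \<Rightarrow> nat"
    and F :: "'a::{field,finite} set"
    and \<beta> \<theta>1 \<theta>2 :: 'a
    and \<epsilon> \<epsilon>' :: real
  assumes q: "primepow q" "odd q"
    and K: "CARD('a) = q\<^sup>2"
    and F: "is_subfield F" "card F = q"
    and \<beta>: "\<beta> \<in> F" "\<beta> \<noteq> 0"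
    and basis: "is_basis2 F \<theta>1 \<theta>2"
    and tr: "Tr q \<theta>1 = \<beta>" "Tr q \<theta>2 = 0"
    and q2: "q\<^sup>2 - 1 = 2 ^ l * q2" "odd q2"
    and q2': "q2' = \<Prod>(prime_factors q2)"
    and fac: "q2' = k * (\<Prod>i=1..s. p i)"
    and p_prime: "\<forall>i\<in>{1..s}. prime (p i)"
    and p_distinct: "inj_on p {1..s}"
    and p_k: "\<forall>i\<in>{1..s}. \<not> p i dvd k"
    and rs: "r \<le> s"
    and p_r: "\<forall>i\<in>{1..r}. p i dvd q + 1"
    and p_s: "\<forall>i\<in>{r<..s}. \<not> p i dvd q + 1"
    and \<epsilon>: "\<epsilon> = 1 - (\<Sum>i=1..s. 1 / real (p i))"
    and \<epsilon>': "\<epsilon>' = 1 - (\<Sum>i=1..r. 1 / real (p i))"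
    and k1: "k1 = \<Prod>{t \<in> prime_factors k. t dvd q + 1}"
    and \<epsilon>_pos: "\<epsilon> > 0"
  shows "([q = 1] (mod 4) \<and>
          real q + 1 > 4 * (real (W k) * ((real s - 1) / \<epsilon> + 2) * sqrt (real q)
            - real (W k1) * ((real r - 1 + \<epsilon>') / \<epsilon> + 1) * ((sqrt (real q) - 1) / 2))
          \<longrightarrow> Q_count F \<theta>1 \<theta>2 q2' \<noteq> 0) \<and>
         ([q = 3] (mod 4) \<and>
          real q + 1 > 4 * (real (W k) * ((real s - 1) / \<epsilon> + 2) * sqrt (real q)
            - real (W k1) * ((real r - 1 + \<epsilon>') / \<epsilon> + 1) * (sqrt (real q) - 1))
          \<longrightarrow> Q_count F \<theta>1 \<theta>2 q2' \<noteq> 0) \<and>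
         (sqrt (real q) \<ge> 4 * real (W k) * ((real s - 1) / \<epsilon> + 2)
          \<longrightarrow> Q_count F \<theta>1 \<theta>2 q2' > 0)"
proof -
  obtain g :: 'a where g: "g \<noteq> 0" "\<And>x. x \<noteq> 0 \<Longrightarrow> \<exists>i::nat. x = g ^ i"
    using exists_generator_of_units by blast
  interpret affine_line g F \<theta>1 \<theta>2 q
  proof unfold_locales
    show "a = 0 \<and> b = 0" if "a \<in> F" "b \<in> F" "a * \<theta>1 + b * \<theta>2 = 0" for a b
      using basis that unfolding is_basis2_def by blast
  qed (use g K q F in auto)
  define P where "P = prime_factors k"
  define P1 where "P1 = {t \<in> P. t dvd q + 1}"
  define R where "R = p ` {1..s}"
  have fin: "finite P" "finite R"
    by (auto simp: P_def R_def)
  have q2'_factors: "prime_factors q2' = prime_factors q2"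
    unfolding q2' by (rule prime_factors_prod_primes) auto
  have q2'_nz: "q2' \<noteq> 0"
    unfolding q2' by (auto simp: prime_factors_dvd)
  have PR: "P \<union> R = prime_factors q2'"
  proof (intro equalityI subsetI)
    fix t assume "t \<in> P \<union> R"
    moreover have "p i dvd q2'" if "i \<in> {1..s}" for i
      unfolding fac using that by (intro dvd_mult dvd_prodI) auto
    ultimately show "t \<in> prime_factors q2'"
      using p_prime q2'_nz by (auto simp: P_def R_def prime_factors_dvd fac)
  next
    fix t assume t: "t \<in> prime_factors q2'"
    then have "t dvd k * (\<Prod>i=1..s. p i)" "prime t"
      by (auto simp: fac prime_factors_dvd)
    then consider "t dvd k" | i where "i \<in> {1..s}" "t dvd p i"
      by (auto simp: prime_dvd_mult_iff prime_dvd_prod_iff)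
    then show "t \<in> P \<union> R"
    proof cases
      case 1
      then show ?thesis
        using \<open>prime t\<close> q2'_nz by (auto simp: P_def prime_factors_dvd fac)
    next
      case 2
      then have "t = p i"
        using \<open>prime t\<close> p_prime by (simp add: primes_dvd_imp_eq)
      then show ?thesis
        using 2 by (auto simp: R_def)
    qed
  qed
  have disj: "P \<inter> R = {}"
    using p_k by (auto simp: P_def R_def prime_factors_dvd)
  have primes: "prime t \<and> odd t \<and> t dvd CARD('a) - 1" if "t \<in> P \<union> R" for t
  proof -
    have "prime t" "t dvd q2"
      using that unfolding PR q2'_factors by (auto simp: prime_factors_dvd)
    moreover have "CARD('a) - 1 = 2 ^ l * q2"
      using q2(1) K by simp
    ultimately show ?thesis
      using q2(2) dvd_trans by (metis dvd_mult)
  qed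
  have W: "W k = 2 ^ card P" "W k1 = 2 ^ card P1"
  proof -
    show "W k = 2 ^ card P"
      by (simp add: W_def P_def)
    have "prime_factors k1 = P1"
      unfolding k1 P1_def P_def by (rule prime_factors_prod_primes) auto
    then show "W k1 = 2 ^ card P1"
      by (simp add: W_def)
  qed
  have sum_R: "(\<Sum>t\<in>R. f t) = (\<Sum>i=1..s. f (p i))" for f :: "nat \<Rightarrow> real"
    unfolding R_def using p_distinct by (simp add: sum.reindex)
  have sum_s: "(\<Sum>i=1..s. 1 - 1 / real (p i)) = real s - 1 + \<epsilon>"
    unfolding \<epsilon> sum_subtractf by simp
  have sum_r: "(\<Sum>i=1..r. 1 - 1 / real (p i)) = real r - 1 + \<epsilon>'"
    unfolding \<epsilon>' sum_subtractf by simp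
  \<comment> \<open>The condition selects precisely the first r primes.\<close>
  have sum_if: "(\<Sum>i=1..s. if p i dvd q + 1 then 1 - 1 / real (p i) else 0) = real r - 1 + \<epsilon>'"
    unfolding sum_r[symmetric] using rs p_r p_s
    by (intro sum.mono_neutral_cong_right) auto
  have nonneg: "real r - 1 + \<epsilon>' \<ge> 0"
    unfolding sum_r[symmetric]
  proof (rule sum_nonneg)
    fix i assume "i \<in> {1..r}"
    then have "p i \<ge> 1"
      using p_prime rs prime_ge_1_nat by (metis atLeastAtMost_iff order_trans)
    then show "0 \<le> 1 - 1 / real (p i)"
      by simp
  qed
  define X where "X = real (W k) * sqrt (real q)"
  define Y where "Y = real (W k1) * (sqrt (real q) - 1)"
  \<comment> \<open>The multiplicity from \<open>combined_bound_eq\<close>; it lets both congruence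
    classes share one argument.\<close>
  define c :: real where "c = (if [q = 3] (mod 4) then 4 else 2)"
  have claim: "Q_count F \<theta>1 \<theta>2 q2' \<noteq> 0"
    if hyp: "4 * (X * ((real s - 1) / \<epsilon> + 2)) - c * Y * ((real r - 1 + \<epsilon>') / \<epsilon> + 1) < real q + 1"
  proof -
    have cb: "combined_bound P d = 4 * X - (if d dvd q + 1 then c * Y else 0)" if "odd d" for d
      unfolding combined_bound_eq[OF that] X_def Y_def c_def W P1_def by simp
    have "(\<Sum>t\<in>R. (1 - 1 / real t) * combined_bound P t) =
        (\<Sum>t\<in>R. (1 - 1 / real t) * (4 * X) - (if t dvd q + 1 then 1 - 1 / real t else 0) * (c * Y))"
      using primes by (intro sum.cong) (auto simp: cb algebra_simps)
    also have "\<dots> = (real s - 1 + \<epsilon>) * (4 * X) - (real r - 1 + \<epsilon>') * (c * Y)"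
      unfolding sum_R sum_subtractf sum_distrib_right[symmetric] sum_if
      using sum_s by (simp add: sum_subtractf)
    finally have "\<epsilon> * combined_bound P 1 + (\<Sum>t\<in>R. (1 - 1 / real t) * combined_bound P t) =
        \<epsilon> * (4 * X - c * Y) + ((real s - 1 + \<epsilon>) * (4 * X) - (real r - 1 + \<epsilon>') * (c * Y))"
      using cb[of 1] by simp
    \<comment> \<open>Collecting coefficients gives s - 1 + 2\<open>\<epsilon>\<close> for
      4\<open>X\<close> and r - 1 + \<open>\<epsilon>'\<close> + \<open>\<epsilon>\<close> for
      c\<open>Y\<close>; factoring out \<open>\<epsilon>\<close> produces the quotients of the
      criterion.\<close>
    also have "\<dots> = \<epsilon> * (4 * (X * ((real s - 1) / \<epsilon> + 2)) - c * Y * ((real r - 1 + \<epsilon>') / \<epsilon> + 1))"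
      using \<epsilon>_pos by (simp add: field_simps)
    also have "\<dots> < \<epsilon> * (real q + 1)"
      using hyp \<epsilon>_pos by (intro mult_strict_left_mono)
    finally have "sieved_set (P \<union> R) \<noteq> {}"
      using \<epsilon>_pos by (intro sieved_set_nonempty[OF fin disj primes]) (auto simp: sum_R \<epsilon>)
    then obtain \<alpha> where \<alpha>: "\<alpha> \<in> sieved_set (P \<union> R)"
      by blast
    then have "\<alpha> \<in> F"
      by (simp add: sieved_set_def)
    then have "m_free q2' (pt \<alpha>)"
      using \<alpha> q2'_nz by (intro m_freeI pt_nonzero) (auto simp: sieved_set_def PR)
    with \<alpha> have "\<alpha> \<in> {\<alpha> \<in> F. m_free q2' (\<theta>1 + \<alpha> * \<theta>2) \<and>
        is_nth_power 2 (\<theta>1 + \<alpha> * \<theta>2) \<and> \<not> is_nth_power 4 (\<theta>1 + \<alpha> * \<theta>2)}"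
      by (simp add: sieved_set_def pt_def)
    then show ?thesis
      unfolding Q_count_def by (subst card_0_eq) auto
  qed
  have part1: "Q_count F \<theta>1 \<theta>2 q2' \<noteq> 0"
    if "[q = 1] (mod 4)" and bound: "real q + 1 > 4 * (real (W k) * ((real s - 1) / \<epsilon> + 2) * sqrt (real q)
            - real (W k1) * ((real r - 1 + \<epsilon>') / \<epsilon> + 1) * ((sqrt (real q) - 1) / 2))"
  proof (rule claim)
    have "c = 2"
      using that(1) by (auto simp: c_def cong_def)
    then show "4 * (X * ((real s - 1) / \<epsilon> + 2)) - c * Y * ((real r - 1 + \<epsilon>') / \<epsilon> + 1) < real q + 1"
      using bound unfolding X_def Y_def by (simp only:) argo
  qed
  have part2: "Q_count F \<theta>1 \<theta>2 q2' \<noteq> 0"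
    if "[q = 3] (mod 4)" and bound: "real q + 1 > 4 * (real (W k) * ((real s - 1) / \<epsilon> + 2) * sqrt (real q)
            - real (W k1) * ((real r - 1 + \<epsilon>') / \<epsilon> + 1) * (sqrt (real q) - 1))"
  proof (rule claim)
    have "c = 4"
      using that(1) by (auto simp: c_def)
    then show "4 * (X * ((real s - 1) / \<epsilon> + 2)) - c * Y * ((real r - 1 + \<epsilon>') / \<epsilon> + 1) < real q + 1"
      using bound unfolding X_def Y_def by (simp only:) argo
  qed
  have part3: "Q_count F \<theta>1 \<theta>2 q2' > 0"
    if "sqrt (real q) \<ge> 4 * real (W k) * ((real s - 1) / \<epsilon> + 2)"
  proof -
    \<comment> \<open>Multiplying by sqrt q bounds the positive part by q. The subtracted part is
      nonnegative for either value of \<open>c\<close>, and the extra 1 in q + 1 gives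
      strictness.\<close>
    have "4 * real (W k) * ((real s - 1) / \<epsilon> + 2) * sqrt (real q) \<le> sqrt (real q) * sqrt (real q)"
      using that by (intro mult_right_mono) auto
    then have "4 * (X * ((real s - 1) / \<epsilon> + 2)) \<le> real q"
      by (simp add: X_def mult_ac)
    moreover have "c * Y * ((real r - 1 + \<epsilon>') / \<epsilon> + 1) \<ge> 0"
      using divide_nonneg_pos[OF nonneg \<epsilon>_pos] q_ge_3
      by (intro mult_nonneg_nonneg) (auto simp: c_def Y_def)
    ultimately have "4 * (X * ((real s - 1) / \<epsilon> + 2)) - c * Y * ((real r - 1 + \<epsilon>') / \<epsilon> + 1) < real q + 1"
      by linarith
    then show ?thesis
      using claim by blast
  qed
  show ?thesis
    using part1 part2 part3 by blast
qed

end
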